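(* Let $n\ge 1$, let $t\ge 1$ be an integer, and let $D\subseteq S_n$ be a nonempty $t$-design in $(S_n,d_S)$ whose half-strength $s=\lfloor (t+1)/2\rfloor$ satisfies $s>1$. Then the covering radius of $D$ satisfies $\rho(D)<n-x(s)$, where $x(s)$ is the largest zero of the Charlier polynomial $C_s$.
   Context: $S_n$ is the symmetric group on $n$ letters with the metric $d_S(\sigma,\theta)=n-F(\sigma\theta^{-1})$, where $F(\nu)$ is the number of fixed points of $\nu$. For $0\le i\le n$ let $E_i=\{(x,y)\in S_n^2: d_S(x,y)=i\}$, and let $w_k$ be the number of permutations of $n$ letters with exactly $k$ fixed points; put $v_j=w_{n-j}$ (so $v_j/n!$ is the proportion of permutations at distance $j$ from a fixed permutation). For a nonempty $D\subseteq S_n$, its frequencies are $f_i=|D^2\cap E_i|/|D|^2$ for $0\le i\le n$ (with $D^2$ the set of ordered pairs). $D$ is a $t$-design if $\sum_{j=0}^n f_j j^i=\sum_{j=0}^n \frac{v_j}{n!}j^i$ for all $i=1,\dots,t$. The half-strength of a $t$-design is $s=\lfloor (t+1)/2\rfloor$. The covering radius is $\rho(D)=\max_{x\in S_n}\min_{y\in D} d_S(x,y)$. The Charlier polynomials are $C_k(x)=(-1)^k+\sum_{i=1}^k(-1)^{k-i}\binom{k}{i}x(x-1)\cdots(x-i+1)$ (exponential generating function $e^t(1-t)^x=\sum_k C_k(x)t^k/k!$); $C_k$ has exactly $k$ real zeros, and $x(k)$ denotes the largest one.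
   Formalization: If D is all of S_n, it is additionally assumed that t ≤ n; without this the claim fails, e.g. n=1, D=S_1, t=3, where ρ(D)=0 but x(2)=(3+√5)/2>1. Proper subsets D are unrestricted. *)

theory Defs
  imports Complex_Main "HOL-Combinatorics.Permutations"
begin

definition Sym :: "nat \<Rightarrow> (nat \<Rightarrow> nat) set" where
  "Sym n = {p. p permutes {1..n}}"

definition num_fix :: "nat \<Rightarrow> (nat \<Rightarrow> nat) \<Rightarrow> nat" where
  "num_fix n p = card {i \<in> {1..n}. p i = i}"

(* The subtraction on nat does not truncate: num_fix n p \<le> n. *)
definition dS :: "nat \<Rightarrow> (nat \<Rightarrow> nat) \<Rightarrow> (nat \<Rightarrow> nat) \<Rightarrow> nat" where
  "dS n \<sigma> \<theta> = n - num_fix n (\<sigma> \<circ> inv \<theta>)"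

definition dist_class :: "nat \<Rightarrow> nat \<Rightarrow> ((nat \<Rightarrow> nat) \<times> (nat \<Rightarrow> nat)) set" where
  "dist_class n i = {(x, y) \<in> Sym n \<times> Sym n. dS n x y = i}"

definition w :: "nat \<Rightarrow> nat \<Rightarrow> nat" where
  "w n k = card {p \<in> Sym n. num_fix n p = k}"

definition v :: "nat \<Rightarrow> nat \<Rightarrow> nat" where
  "v n j = w n (n - j)"

definition frequency :: "nat \<Rightarrow> (nat \<Rightarrow> nat) set \<Rightarrow> nat \<Rightarrow> real" where
  "frequency n D i = real (card ((D \<times> D) \<inter> dist_class n i)) / (real (card D))\<^sup>2"

(* There is no upper bound on t here: Sym n itself is a t-design for every t. *)
definition is_design :: "nat \<Rightarrow> nat \<Rightarrow> (nat \<Rightarrow> nat) set \<Rightarrow> bool" where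
  "is_design n t D \<longleftrightarrow>
     (\<forall>i\<in>{1..t}. (\<Sum>j=0..n. frequency n D j * real j ^ i)
               = (\<Sum>j=0..n. real (v n j) / fact n * real j ^ i))"

definition half_strength :: "nat \<Rightarrow> nat" where
  "half_strength t = (t + 1) div 2"

definition covering_radius :: "nat \<Rightarrow> (nat \<Rightarrow> nat) set \<Rightarrow> nat" where
  "covering_radius n D = Max ((\<lambda>x. Min ((\<lambda>y. dS n x y) ` D)) ` Sym n)"

(* Monic normalization, with exponential generating function exp (-t) * (1 + t) powr x. *)
definition charlier :: "nat \<Rightarrow> real \<Rightarrow> real" where
  "charlier k x = (-1) ^ k +
     (\<Sum>i=1..k. (-1) ^ (k - i) * real (k choose i) * (\<Prod>j<i. x - real j))"

(* charlier k is a polynomial function of degree k with k real zeros, so for k \<ge> 1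
   this is the maximum of a finite nonempty set. *)
definition largest_zero :: "nat \<Rightarrow> real" where
  "largest_zero k = Max {x. charlier k x = 0}"

end

theory Submission
  imports Defs "HOL-Computational_Algebra.Polynomial"
begin

text \<open>The \<open>k\<close>-th falling factorial of the number of agreements of two permutations is an inner
  product of feature vectors, so the averaged condition defining a design already determines
  the factorial moments up to order \<open>t\<close> of the number \<open>F\<close> of agreements of each single
  \<open>x\<close> with a random \<open>y \<in> D\<close>: they are those of the Poisson distribution, for which
  the Charlier polynomials are orthogonal. Write \<open>C\<^sub>s(X) = (X - r) q(X)\<close> with \<open>r\<close> the largest
  zero. Then \<open>C\<^sub>s q\<close> has mean 0, so if \<open>F \<le> r\<close> throughout, \<open>F\<close> takes only zeros of
  \<open>C\<^sub>s\<close> as values. A natural zero of \<open>C\<^sub>s\<close> divides the constant coefficient \<open>\<plusminus>1\<close>,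
  hence \<open>F = 1\<close> always, which contradicts the second factorial moment.\<close>

section \<open>Falling factorials and the difference calculus of Charlier polynomials\<close>

definition falling :: "nat \<Rightarrow> real \<Rightarrow> real" where
  "falling k x = (\<Prod>j<k. x - real j)"

lemma falling_0 [simp]: "falling 0 x = 1"
  by (simp add: falling_def)

lemma falling_Suc: "falling (Suc k) x = falling k x * (x - real k)"
  by (simp add: falling_def)

lemma falling_Suc_shift: "falling (Suc k) x = x * falling k (x - 1)"
  unfolding falling_def by (subst prod.lessThan_Suc_shift) (simp add: algebra_simps)

text \<open>The forward difference acts on falling factorials as differentiation acts on powers:
  both sides are \<open>falling k x\<close> times a linear factor, \<open>x + 1\<close> against
  \<open>x - k\<close>, and these differ by \<open>k + 1\<close>.\<close>

lemma falling_diff: "falling (Suc k) (x + 1) = falling (Suc k) x + (real k + 1) * falling k x"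
  using falling_Suc_shift[of k "x + 1"] falling_Suc[of k x] by (simp add: algebra_simps)

lemma falling_add: "falling (j + k) x = falling j x * falling k (x - real j)"
  by (induction k) (simp_all add: falling_Suc algebra_simps)

lemma charlier_eq:
  "charlier k x = (\<Sum>i\<le>k. (-1) ^ (k - i) * real (k choose i) * falling i x)"
proof -
  have "{..k} = insert 0 {1..k}" by auto
  then show ?thesis by (simp add: charlier_def falling_def)
qed

text \<open>The Charlier polynomials are an Appell sequence for the forward difference. Differencing
  termwise lowers each falling factorial, and absorption, (i+1) binom(k+1, i+1) = (k+1) binom(k, i),
  pulls out the factor \<open>Suc k\<close>.\<close>

lemma charlier_shift:
  "charlier (Suc k) (x + 1) = charlier (Suc k) x + real (Suc k) * charlier k x"
proof -
  have pascal: "real (Suc k choose Suc i) * (real i + 1) = real (Suc k) * real (k choose i)" for i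
    using Suc_times_binomial[of i k]
    by (metis mult.commute of_nat_Suc of_nat_mult add.commute)
  have eq: "(-1) ^ (k - i) * real (Suc k choose Suc i) * ((real i + 1) * falling i x)
      = real (Suc k) * ((-1) ^ (k - i) * real (k choose i) * falling i x)" for i
  proof -
    have "(-1) ^ (k - i) * real (Suc k choose Suc i) * ((real i + 1) * falling i x)
        = (-1) ^ (k - i) * (real (Suc k choose Suc i) * (real i + 1)) * falling i x"
      by (simp only: mult.assoc)
    also have "\<dots> = (-1) ^ (k - i) * (real (Suc k) * real (k choose i)) * falling i x"
      by (simp only: pascal)
    finally show ?thesis by (simp only: mult_ac)
  qed
  show ?thesis
    unfolding charlier_eq sum.atMost_Suc_shift[of _ k] falling_diff distrib_left sum.distrib
      diff_Suc_Suc eq by (simp add: sum_distrib_left)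
qed

section \<open>Orthogonality from constant factorial moments\<close>

lemma alternating_binomial_sum:
  assumes "k > 0"
  shows "(\<Sum>i\<le>k. (-1) ^ (k - i) * real (k choose i)) = 0"
  using binomial_ring[of 1 "-1 :: real" k] assms by (simp add: mult.commute power_0_left)

text \<open>For \<open>m = 0\<close> the product expands by \<open>falling_add\<close> into falling
  factorials, all with the same sum \<open>M\<close>, leaving \<open>M\<close> times the expansion
  of (1 - 1)^k. Each further unit of shift costs one degree through \<open>charlier_shift\<close>,
  which \<open>m < k\<close> permits. The case \<open>m = j\<close> is orthogonality to
  \<open>falling j\<close>.\<close>

lemma charlier_orthogonal_shifted:
  fixes X :: "'a \<Rightarrow> real"
  assumes moments: "\<And>k. k \<le> n \<Longrightarrow> (\<Sum>y\<in>D. falling k (X y)) = M"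
    and "m < k" and "j + k \<le> n"
  shows "(\<Sum>y\<in>D. falling j (X y) * charlier k (X y - real j + real m)) = 0"
  using assms(2,3)
proof (induction m arbitrary: k)
  case 0
  have "(\<Sum>y\<in>D. falling j (X y) * charlier k (X y - real j))
      = (\<Sum>i\<le>k. (-1) ^ (k - i) * real (k choose i) * (\<Sum>y\<in>D. falling (j + i) (X y)))"
    unfolding charlier_eq sum_distrib_left falling_add
    by (subst sum.swap) (simp add: mult_ac)
  also have "\<dots> = (\<Sum>i\<le>k. (-1) ^ (k - i) * real (k choose i)) * M"
    unfolding sum_distrib_right using 0 by (intro sum.cong) (simp_all add: moments)
  finally show ?case using 0 by (simp add: alternating_binomial_sum)
next
  case (Suc m)
  then obtain l where k: "k = Suc l" by (cases k) auto
  have "charlier k (X y - real j + real (Suc m))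
     = charlier k (X y - real j + real m) + real k * charlier l (X y - real j + real m)" for y
    using charlier_shift[of l "X y - real j + real m"] by (simp add: k add_ac)
  moreover have "(\<Sum>y\<in>D. falling j (X y) * charlier k (X y - real j + real m)) = 0"
    and "(\<Sum>y\<in>D. falling j (X y) * charlier l (X y - real j + real m)) = 0"
    using Suc k by simp_all
  ultimately show ?case
    by (simp add: distrib_left sum.distrib mult.left_commute[of _ "real k"]
        flip: sum_distrib_left)
qed

lemma poly_falling_expansion:
  assumes "degree q \<le> d"
  shows "\<exists>c. \<forall>x. poly q x = (\<Sum>j\<le>d. c j * falling j x)"
  using assms
proof (induction d arbitrary: q)
  case 0
  then obtain a where "q = [:a:]" by (metis degree_eq_zeroE le_zero_eq)
  then show ?case by auto
next
  case (Suc d)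
  obtain a p where q: "q = pCons a p" by (cases q)
  have "degree p \<le> d" using Suc.prems by (simp add: q split: if_splits)
  from Suc.IH[OF this] obtain c where c: "\<And>x. poly p x = (\<Sum>j\<le>d. c j * falling j x)"
    by blast
  \<comment> \<open>These coefficients come from \<open>q = a + x * p\<close> and the identity
    \<open>x * falling j x = falling (Suc j) x + j * falling j x\<close>.\<close>
  define e where "e j = (if j = 0 then a else c (j - 1)) + (if j \<le> d then real j * c j else 0)" for j
  have "poly q x = (\<Sum>j\<le>Suc d. e j * falling j x)" for x
  proof -
    have "(\<Sum>j\<le>Suc d. e j * falling j x)
        = (\<Sum>j\<le>Suc d. (if j = 0 then a else c (j - 1)) * falling j x)
          + (\<Sum>j\<le>Suc d. (if j \<le> d then real j * c j else 0) * falling j x)"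
      by (simp only: e_def distrib_right sum.distrib)
    also have "(\<Sum>j\<le>Suc d. (if j \<le> d then real j * c j else 0) * falling j x)
        = (\<Sum>j\<le>d. real j * c j * falling j x)"
      by simp
    also have "(\<Sum>j\<le>Suc d. (if j = 0 then a else c (j - 1)) * falling j x)
        = a + (\<Sum>j\<le>d. c j * falling j x * (x - real j))"
      by (subst sum.atMost_Suc_shift) (simp add: falling_Suc mult.assoc)
    finally show ?thesis
      by (simp add: q c sum_distrib_left algebra_simps sum_subtractf)
  qed
  then show ?case by blast
qed

text \<open>The product has degree at most s + (s - 1), hence the bound on \<open>n\<close>. By
  linearity it suffices to test against \<open>falling j\<close> for \<open>j < s\<close>.\<close>

lemma charlier_orthogonal:
  fixes X :: "'a \<Rightarrow> real"
  assumes moments: "\<And>k. k \<le> n \<Longrightarrow> (\<Sum>y\<in>D. falling k (X y)) = M"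
    and "degree q < s" and "2 * s - 1 \<le> n"
  shows "(\<Sum>y\<in>D. charlier s (X y) * poly q (X y)) = 0"
proof -
  obtain c where c: "\<And>x. poly q x = (\<Sum>j\<le>degree q. c j * falling j x)"
    using poly_falling_expansion[of q "degree q"] by blast
  have "(\<Sum>y\<in>D. charlier s (X y) * poly q (X y))
      = (\<Sum>j\<le>degree q. c j * (\<Sum>y\<in>D. falling j (X y) * charlier s (X y)))"
    unfolding c sum_distrib_left by (subst sum.swap) (simp add: mult_ac)
  also have "\<dots> = 0"
  proof (intro sum.neutral ballI)
    fix j assume "j \<in> {..degree q}"
    then have "(\<Sum>y\<in>D. falling j (X y) * charlier s (X y - real j + real j)) = 0"
      using assms by (intro charlier_orthogonal_shifted[where n = n and M = M]) auto
    then show "c j * (\<Sum>y\<in>D. falling j (X y) * charlier s (X y)) = 0" by simp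
  qed
  finally show ?thesis .
qed

section \<open>Zeros of Charlier polynomials\<close>

definition falling_poly :: "nat \<Rightarrow> real poly" where
  "falling_poly k = (\<Prod>j<k. [:- real j, 1:])"

lemma poly_falling_poly [simp]: "poly (falling_poly k) x = falling k x"
  by (simp add: falling_poly_def falling_def poly_prod)

lemma degree_falling_poly: "degree (falling_poly k) \<le> k"
  unfolding falling_poly_def
  using degree_prod_sum_le[of "{..<k}" "\<lambda>j. [:- real j, 1:]"] by simp

definition charlier_poly :: "nat \<Rightarrow> real poly" where
  "charlier_poly k = (\<Sum>i\<le>k. smult ((-1) ^ (k - i) * real (k choose i)) (falling_poly i))"

lemma poly_charlier_poly [simp]: "poly (charlier_poly k) x = charlier k x"
  by (simp add: charlier_poly_def charlier_eq poly_sum)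

lemma degree_charlier_poly: "degree (charlier_poly k) \<le> k"
  unfolding charlier_poly_def
  by (intro degree_sum_le) (auto intro: order_trans[OF degree_smult_le] order_trans[OF degree_falling_poly])

lemma charlier_at_0: "charlier k 0 = (-1) ^ k"
proof -
  have "falling i 0 = 0" if "i \<ge> 1" for i
    using that by (cases i) (simp_all add: falling_Suc_shift)
  then show ?thesis
    unfolding charlier_def falling_def[symmetric] by simp
qed

lemma charlier_at_1: "charlier (Suc k) 1 = (-1) ^ k * real k"
  using charlier_shift[of k 0] by (simp add: charlier_at_0 algebra_simps)

lemma charlier_poly_nonzero: "charlier_poly k \<noteq> 0"
  using poly_charlier_poly[of k 0] by (auto simp: charlier_at_0 simp del: poly_charlier_poly)

lemma finite_charlier_zeros: "finite {x. charlier k x = 0}"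
  using poly_roots_finite[OF charlier_poly_nonzero[of k]] by simp

text \<open>The values at 0 and 1 have opposite signs. Existence makes the \<open>Max\<close> in
  \<open>largest_zero\<close> a maximum over a nonempty finite set, hence itself a zero.\<close>

lemma charlier_zero_exists:
  assumes "k > 1"
  shows "\<exists>x. charlier k x = 0"
proof -
  obtain l where k: "k = Suc l" using assms by (cases k) auto
  have cont: "continuous_on {0..1} (charlier k)"
    unfolding charlier_eq falling_def by (intro continuous_intros)
  show ?thesis
  proof (cases "even l")
    case True
    with k assms have "charlier k 0 \<le> 0" "0 \<le> charlier k 1"
      by (simp_all add: charlier_at_0 charlier_at_1)
    with IVT'[of "charlier k" 0 0 1] cont show ?thesis by auto
  next
    case False
    with k assms have "charlier k 1 \<le> 0" "0 \<le> charlier k 0"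
      by (simp_all add: charlier_at_0 charlier_at_1)
    with IVT2'[of "charlier k" 1 0 0] cont show ?thesis by auto
  qed
qed

lemma charlier_largest_zero:
  assumes "k > 1"
  shows "charlier k (largest_zero k) = 0"
proof -
  have "largest_zero k \<in> {x. charlier k x = 0}"
    unfolding largest_zero_def
    using charlier_zero_exists[OF assms] by (intro Max_in finite_charlier_zeros) auto
  then show ?thesis by simp
qed

text \<open>The constant coefficient is a unit, so the only candidate for a natural zero is its divisor 1.\<close>

lemma charlier_nat_zero:
  assumes "charlier k (real m) = 0"
  shows "m = 1"
proof -
  define S where "S = (\<Sum>i=1..k. (-1) ^ (k - i) * int (k choose i) * (\<Prod>j<i. int m - int j))"
  have "charlier k (real m) = of_int ((-1) ^ k + S)"
    by (simp add: charlier_def S_def)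
  with assms have "(-1) ^ k + S = 0" by linarith
  moreover have "int m dvd S"
    unfolding S_def
  proof (intro dvd_sum dvd_mult)
    fix i assume "i \<in> {1..k}"
    then show "int m dvd (\<Prod>j<i. int m - int j)"
      using dvd_prodI[of "{..<i}" 0 "\<lambda>j. int m - int j"] by simp
  qed
  ultimately have "int m dvd (-1) ^ k"
    by (metis add.inverse_unique dvd_minus_iff add.commute)
  then have "int m dvd 1"
    by (metis dvd_minus_iff minus_one_power_iff)
  then show ?thesis by simp
qed

lemma exceeds_largest_charlier_zero:
  fixes F :: "'a \<Rightarrow> nat"
  assumes "finite D" and "M \<noteq> 0"
    and moments: "\<And>k. k \<le> n \<Longrightarrow> (\<Sum>y\<in>D. falling k (real (F y))) = M"
    and s: "s > 1" "2 * s - 1 \<le> n"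
  shows "\<exists>y\<in>D. largest_zero s < real (F y)"
proof (rule ccontr)
  assume contr: "\<not> ?thesis"
  define r where "r = largest_zero s"
  have "poly (charlier_poly s) r = 0"
    using charlier_largest_zero[OF s(1)] by (simp add: r_def)
  then obtain q where q: "charlier_poly s = [:- r, 1:] * q"
    unfolding poly_eq_0_iff_dvd by (elim dvdE)
  with charlier_poly_nonzero[of s] have "q \<noteq> 0" by auto
  then have "degree (charlier_poly s) = 1 + degree q"
    by (simp add: q degree_mult_eq del: mult_pCons_left)
  then have "degree q < s" using degree_charlier_poly[of s] by simp
  then have "(\<Sum>y\<in>D. charlier s (real (F y)) * poly q (real (F y))) = 0"
    using charlier_orthogonal[where n = n and M = M and X = "\<lambda>y. real (F y)"] moments s(2) by blast
  moreover have C: "charlier s x = (x - r) * poly q x" for x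
    using poly_charlier_poly[of s x] by (simp add: q algebra_simps)
  \<comment> \<open>The sign is flipped so that, under the assumption that no \<open>F y\<close>
    exceeds \<open>r\<close>, every summand is nonnegative and therefore zero.\<close>
  ultimately have "(\<Sum>y\<in>D. (r - real (F y)) * (poly q (real (F y)))\<^sup>2) = 0"
    by (simp add: power2_eq_square left_diff_distrib sum_subtractf mult.assoc)
  moreover have "(r - real (F y)) * (poly q (real (F y)))\<^sup>2 \<ge> 0" if "y \<in> D" for y
    using contr that by (auto simp: r_def not_less)
  ultimately have "(r - real (F y)) * (poly q (real (F y)))\<^sup>2 = 0" if "y \<in> D" for y
    using that \<open>finite D\<close> by (simp add: sum_nonneg_eq_0_iff)
  \<comment> \<open>Either \<open>F y = r\<close> or \<open>q\<close> vanishes at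
    \<open>F y\<close>; both make the factored form \<open>C\<close> zero.\<close>
  then have "charlier s (real (F y)) = 0" if "y \<in> D" for y
    using that by (fastforce simp: C)
  then have "F y = 1" if "y \<in> D" for y
    using that charlier_nat_zero by blast
  then have "(\<Sum>y\<in>D. falling 2 (real (F y))) = 0"
    by (simp add: falling_def numeral_2_eq_2)
  moreover have "2 \<le> n" using s by linarith
  ultimately show False using moments[of 2] \<open>M \<noteq> 0\<close> by simp
qed

section \<open>Mean feature vectors of a kernel\<close>

text \<open>A positive semidefinite kernel whose mean over \<open>D \<times> D\<close> equals its mean over \<open>S \<times> S\<close>
  forces the mean feature vectors of \<open>D\<close> and \<open>S\<close> to coincide.\<close>

lemma kernel_mean_eq:
  fixes \<phi> :: "'a \<Rightarrow> 'i \<Rightarrow> real"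
  assumes fin: "finite S" "D \<subseteq> S" "D \<noteq> {}" "finite I"
    and K: "\<And>x y. x \<in> S \<Longrightarrow> y \<in> S \<Longrightarrow> K x y = (\<Sum>i\<in>I. \<phi> x i * \<phi> y i)"
    and row: "\<And>x. x \<in> S \<Longrightarrow> (\<Sum>y\<in>S. K x y) = real (card S) * M"
    and D: "(\<Sum>x\<in>D. \<Sum>y\<in>D. K x y) = (real (card D))\<^sup>2 * M"
    and x: "x \<in> S"
  shows "(\<Sum>y\<in>D. K x y) = real (card D) * M"
proof -
  have finD: "finite D" using fin finite_subset by blast
  have pos: "card D > 0" "card S > 0" using fin finD by (auto simp: card_gt_0_iff)
  define P where "P A i = (\<Sum>x\<in>A. \<phi> x i)" for A i
  have PP: "(\<Sum>i\<in>I. P A i * P B i) = (\<Sum>x\<in>A. \<Sum>y\<in>B. K x y)" if "A \<subseteq> S" "B \<subseteq> S" for A B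
  proof -
    have "(\<Sum>i\<in>I. P A i * P B i) = (\<Sum>i\<in>I. \<Sum>x\<in>A. \<Sum>y\<in>B. \<phi> x i * \<phi> y i)"
      by (simp add: P_def sum_product)
    also have "\<dots> = (\<Sum>x\<in>A. \<Sum>y\<in>B. \<Sum>i\<in>I. \<phi> x i * \<phi> y i)"
      by (subst sum.swap, intro sum.cong refl, subst sum.swap, simp)
    also have "\<dots> = (\<Sum>x\<in>A. \<Sum>y\<in>B. K x y)"
      using that by (intro sum.cong refl K[symmetric]) auto
    finally show ?thesis .
  qed
  let ?s = "real (card S)" and ?d = "real (card D)"
  \<comment> \<open>The squared norm of the difference of the mean vectors, scaled to avoid
    division. All three inner products are \<open>M\<close> times the product of the two
    cardinalities, so the terms cancel as 1 - 2 + 1.\<close>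
  have "(\<Sum>i\<in>I. (?s * P D i - ?d * P S i)\<^sup>2)
     = ?s\<^sup>2 * (\<Sum>i\<in>I. P D i * P D i) - 2 * ?s * ?d * (\<Sum>i\<in>I. P D i * P S i)
       + ?d\<^sup>2 * (\<Sum>i\<in>I. P S i * P S i)"
    by (simp add: power2_eq_square algebra_simps sum.distrib sum_subtractf sum_distrib_left)
  also have "(\<Sum>i\<in>I. P D i * P D i) = ?d\<^sup>2 * M"
    using fin by (simp add: PP D)
  also have "(\<Sum>i\<in>I. P D i * P S i) = ?d * (?s * M)"
    using fin by (simp add: PP row subset_iff)
  also have "(\<Sum>i\<in>I. P S i * P S i) = ?s * (?s * M)"
    by (simp add: PP row)
  also have "?s\<^sup>2 * (?d\<^sup>2 * M) - 2 * ?s * ?d * (?d * (?s * M)) + ?d\<^sup>2 * (?s * (?s * M)) = 0"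
    by (simp add: power2_eq_square algebra_simps)
  finally have eq: "?s * P D i = ?d * P S i" if "i \<in> I" for i
    using that fin by (simp add: sum_nonneg_eq_0_iff)
  have "?s * (\<Sum>y\<in>D. K x y) = ?s * (\<Sum>i\<in>I. P {x} i * P D i)"
    using PP[of "{x}" D] fin x by simp
  also have "\<dots> = (\<Sum>i\<in>I. P {x} i * (?s * P D i))"
    by (simp add: sum_distrib_left mult_ac)
  also have "\<dots> = ?d * (\<Sum>i\<in>I. P {x} i * P S i)"
    by (simp add: eq sum_distrib_left mult_ac)
  also have "\<dots> = ?d * (?s * M)"
    using PP[of "{x}" S] x by (simp add: row)
  finally show ?thesis using pos by simp
qed

section \<open>Ordered tuples and agreements of permutations\<close>

text \<open>Lists instead of subsets: their number is a falling factorial without a division by k!,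
  and permutations act on them by \<open>map\<close>.\<close>

definition injective_lists :: "nat \<Rightarrow> 'a set \<Rightarrow> 'a list set" where
  "injective_lists k A = {xs. length xs = k \<and> distinct xs \<and> set xs \<subseteq> A}"

lemma finite_injective_lists: "finite A \<Longrightarrow> finite (injective_lists k A)"
  unfolding injective_lists_def
  by (rule finite_subset[OF _ finite_lists_length_eq[of A k]]) auto

lemma card_injective_lists:
  assumes "finite A"
  shows "real (card (injective_lists k A)) = falling k (real (card A))"
proof (induction k)
  case 0
  have "injective_lists 0 A = {[]}" by (auto simp: injective_lists_def)
  then show ?case by simp
next
  case (Suc k)
  have "injective_lists (Suc k) A
      = (\<lambda>(xs, a). a # xs) ` (SIGMA xs:injective_lists k A. A - set xs)"
    by (auto simp: injective_lists_def length_Suc_conv image_iff)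
  moreover have "inj_on (\<lambda>(xs, a). a # xs) (SIGMA xs:injective_lists k A. A - set xs)"
    by (auto simp: inj_on_def)
  ultimately have "card (injective_lists (Suc k) A)
      = (\<Sum>xs\<in>injective_lists k A. card (A - set xs))"
    using assms by (simp add: card_image card_SigmaI finite_injective_lists)
  then have "real (card (injective_lists (Suc k) A))
      = (\<Sum>xs\<in>injective_lists k A. real (card (A - set xs)))"
    by simp
  also have "\<dots> = (\<Sum>xs\<in>injective_lists k A. real (card A) - real k)"
  proof (intro sum.cong refl)
    fix xs assume "xs \<in> injective_lists k A"
    then have "set xs \<subseteq> A" "card (set xs) = k"
      by (auto simp: injective_lists_def distinct_card)
    then show "real (card (A - set xs)) = real (card A) - real k"
      \<comment> \<open>An \<open>xs\<close> inside \<open>A\<close> forces \<open>k\<close> to be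
        at most \<open>card A\<close>, so the subtraction on naturals does not truncate.\<close>
      using assms card_mono[of A "set xs"] by (simp add: card_Diff_subset of_nat_diff)
  qed
  finally show ?case by (simp add: Suc falling_Suc)
qed

lemma falling_fact:
  assumes "k \<le> n"
  shows "falling k (real n) * fact (n - k) = fact n"
  using assms
proof (induction k)
  case (Suc k)
  then have "fact (n - k) = (real n - real k) * fact (n - Suc k)"
    by (subst fact_reduce) (auto simp: of_nat_diff)
  with Suc show ?case by (simp add: falling_Suc mult.assoc)
qed simp

lemma finite_Sym: "finite (Sym n)"
  by (simp add: Sym_def finite_permutations)

lemma card_Sym: "card (Sym n) = fact n"
  by (simp add: Sym_def card_permutations)

lemma num_fix_le: "num_fix n p \<le> n"
  unfolding num_fix_def using card_mono[of "{1..n}" "{i \<in> {1..n}. p i = i}"] by fastforce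

text \<open>The permutation \<open>y\<close> carries the positions where \<open>x\<close> and
  \<open>y\<close> agree bijectively onto the fixed points of
  \<open>x \<circ> inv y\<close>.\<close>

lemma num_fix_comp_inv:
  assumes "x \<in> Sym n" "y \<in> Sym n"
  shows "num_fix n (x \<circ> inv y) = card {b \<in> {1..n}. x b = y b}"
proof -
  have y: "y permutes {1..n}" using assms by (simp add: Sym_def)
  have "{i \<in> {1..n}. (x \<circ> inv y) i = i} = y ` {b \<in> {1..n}. x b = y b}"
  proof (intro equalityI subsetI)
    fix i assume "i \<in> {i \<in> {1..n}. (x \<circ> inv y) i = i}"
    then have "inv y i \<in> {b \<in> {1..n}. x b = y b}" "i = y (inv y i)"
      using permutes_in_image[OF permutes_inv[OF y]] permutes_inverses[OF y] by auto
    then show "i \<in> y ` {b \<in> {1..n}. x b = y b}" by blast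
  next
    fix i assume "i \<in> y ` {b \<in> {1..n}. x b = y b}"
    then show "i \<in> {i \<in> {1..n}. (x \<circ> inv y) i = i}"
      using permutes_in_image[OF y] permutes_inverses[OF y] by auto
  qed
  then show ?thesis
    using permutes_inj_on[OF y] by (simp add: num_fix_def card_image)
qed

text \<open>Double counting of pairs of a permutation and a \<open>k\<close>-tuple that it fixes
  pointwise: there are n!/(n-k)! tuples, each fixed by (n-k)! permutations. On average the factorial
  moment is 1, as for the Poisson distribution of mean 1.\<close>

lemma sum_falling_num_fix:
  assumes "k \<le> n"
  shows "(\<Sum>p\<in>Sym n. falling k (real (num_fix n p))) = fact n"
proof -
  have *: "falling k (real (num_fix n p))
      = (\<Sum>b\<in>injective_lists k {1..n}. of_bool (\<forall>a\<in>set b. p a = a))" for p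
  proof -
    have "injective_lists k {i \<in> {1..n}. p i = i}
        = injective_lists k {1..n} \<inter> {b. \<forall>a\<in>set b. p a = a}"
      by (auto simp: injective_lists_def)
    then show ?thesis
      unfolding num_fix_def
      by (subst card_injective_lists[symmetric]) (simp_all add: finite_injective_lists Int_def)
  qed
  have stab: "(\<Sum>p\<in>Sym n. of_bool (\<forall>a\<in>set b. p a = a)) = (fact (n - k) :: real)"
    if b: "b \<in> injective_lists k {1..n}" for b
  proof -
    have "Sym n \<inter> {p. \<forall>a\<in>set b. p a = a} = {p. p permutes {1..n} - set b}"
      by (auto simp: Sym_def intro: permutes_superset permutes_subset permutes_not_in)
    moreover have "card ({1..n} - set b) = n - k"
      using b by (auto simp: injective_lists_def card_Diff_subset distinct_card)
    ultimately show ?thesis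
      by (simp add: finite_Sym card_permutations)
  qed
  have "(\<Sum>p\<in>Sym n. falling k (real (num_fix n p)))
      = (\<Sum>b\<in>injective_lists k {1..n}. fact (n - k))"
    unfolding * by (subst sum.swap) (simp add: stab)
  also have "\<dots> = fact n"
    using falling_fact[OF assms] by (simp add: card_injective_lists)
  finally show ?thesis .
qed

lemma sum_Sym_comp_inv:
  assumes "x \<in> Sym n"
  shows "(\<Sum>y\<in>Sym n. g (x \<circ> inv y)) = (\<Sum>p\<in>Sym n. g p)"
proof -
  have x: "x permutes {1..n}" using assms by (simp add: Sym_def)
  have "bij_betw (\<lambda>y. x \<circ> inv y) (Sym n) (Sym n)"
  proof (rule bij_betwI[where g = "\<lambda>p. inv p \<circ> x"])
    show "(\<lambda>y. x \<circ> inv y) \<in> Sym n \<rightarrow> Sym n" "(\<lambda>p. inv p \<circ> x) \<in> Sym n \<rightarrow> Sym n"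
      using x by (auto simp: Sym_def intro: permutes_compose permutes_inv)
  next
    fix y assume "y \<in> Sym n"
    then have y: "y permutes {1..n}" by (simp add: Sym_def)
    have "inv (x \<circ> inv y) = y \<circ> inv x"
      using x y by (simp add: permutation_permutes permutes_bij bij_imp_bij_inv o_inv_distrib inv_inv_eq)
    then show "inv (x \<circ> inv y) \<circ> x = y"
      using permutes_inv_o[OF x] by (simp add: o_assoc[symmetric])
    have "inv (inv y \<circ> x) = inv x \<circ> y"
      using x y by (simp add: permutes_bij bij_imp_bij_inv o_inv_distrib inv_inv_eq)
    then show "x \<circ> inv (inv y \<circ> x) = y"
      using permutes_inv_o[OF x] by (simp add: o_assoc)
  qed
  then show ?thesis by (rule sum.reindex_bij_betw)
qed

text \<open>The feature vector of \<open>x\<close> is the indicator of the graph of its action on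
  \<open>k\<close>-tuples. The inner product counts the common points of two graphs, which are the
  tuples of positions where \<open>x\<close> and \<open>y\<close> agree.\<close>

lemma falling_kernel:
  assumes "x \<in> Sym n" "y \<in> Sym n"
  shows "falling k (real (num_fix n (x \<circ> inv y)))
    = (\<Sum>(b, a)\<in>injective_lists k {1..n} \<times> injective_lists k {1..n}.
        of_bool (map x b = a) * of_bool (map y b = a))"
proof -
  let ?T = "injective_lists k {1..n}"
  have x: "x permutes {1..n}" using assms by (simp add: Sym_def)
  have "map x b \<in> ?T" if "b \<in> ?T" for b
    using that permutes_in_image[OF x] permutes_inj_on[OF x]
    by (auto simp: injective_lists_def distinct_map)
  \<comment> \<open>For fixed \<open>b\<close> only the index \<open>a = map x b\<close> can
    contribute.\<close>
  then have *: "(\<Sum>a\<in>?T. of_bool (map x b = a) * of_bool (map y b = a))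
      = (of_bool (map x b = map y b) :: real)" if "b \<in> ?T" for b
    using that by (subst sum.remove[of _ "map x b"])
      (auto simp del: map_eq_conv simp: finite_injective_lists intro!: sum.neutral)
  have "injective_lists k {b \<in> {1..n}. x b = y b} = ?T \<inter> {b. map x b = map y b}"
    by (auto simp: injective_lists_def)
  then have "falling k (real (num_fix n (x \<circ> inv y))) = (\<Sum>b\<in>?T. of_bool (map x b = map y b))"
    unfolding num_fix_comp_inv[OF assms]
    by (subst card_injective_lists[symmetric]) (simp_all add: finite_injective_lists)
  also have "\<dots> = (\<Sum>b\<in>?T. \<Sum>a\<in>?T. of_bool (map x b = a) * of_bool (map y b = a))"
    by (intro sum.cong refl *[symmetric])
  finally show ?thesis by (simp add: sum.cartesian_product)
qed

section \<open>Moments of designs\<close>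

lemma sum_v:
  "(\<Sum>j=0..n. real (v n j) / fact n * g j) = (\<Sum>p\<in>Sym n. g (n - num_fix n p)) / fact n"
proof -
  have "(\<Sum>p\<in>Sym n. g (n - num_fix n p))
      = (\<Sum>j=0..n. \<Sum>p\<in>{p \<in> Sym n. n - num_fix n p = j}. g (n - num_fix n p))"
    by (rule sum.group[symmetric]) (auto simp: finite_Sym)
  also have "\<dots> = (\<Sum>j=0..n. real (v n j) * g j)"
  proof (intro sum.cong refl)
    fix j assume "j \<in> {0..n}"
    then have eq: "{p \<in> Sym n. n - num_fix n p = j} = {p \<in> Sym n. num_fix n p = n - j}"
      using num_fix_le[of n] by (auto simp: le_imp_diff_is_add)
    have "(\<Sum>p\<in>{p \<in> Sym n. n - num_fix n p = j}. g (n - num_fix n p))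
        = (\<Sum>p\<in>{p \<in> Sym n. n - num_fix n p = j}. g j)"
      by (intro sum.cong) auto
    then show "(\<Sum>p\<in>{p \<in> Sym n. n - num_fix n p = j}. g (n - num_fix n p)) = real (v n j) * g j"
      by (simp add: v_def w_def eq)
  qed
  finally show ?thesis by (simp add: sum_divide_distrib)
qed

lemma sum_frequency:
  assumes "D \<subseteq> Sym n"
  shows "(\<Sum>j=0..n. frequency n D j * g j)
    = (\<Sum>x\<in>D. \<Sum>y\<in>D. g (dS n x y)) / (real (card D))\<^sup>2"
proof -
  have fin: "finite (D \<times> D)" using assms finite_Sym finite_subset by blast
  have "(\<Sum>x\<in>D. \<Sum>y\<in>D. g (dS n x y)) = (\<Sum>z\<in>D \<times> D. g (dS n (fst z) (snd z)))"
    by (simp add: sum.cartesian_product case_prod_beta)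
  also have "\<dots> = (\<Sum>j=0..n. \<Sum>z\<in>{z \<in> D \<times> D. dS n (fst z) (snd z) = j}. g (dS n (fst z) (snd z)))"
    using fin by (intro sum.group[symmetric]) (auto simp: dS_def)
  also have "\<dots> = (\<Sum>j=0..n. real (card ((D \<times> D) \<inter> dist_class n j)) * g j)"
  proof (intro sum.cong refl)
    fix j
    have "{z \<in> D \<times> D. dS n (fst z) (snd z) = j} = (D \<times> D) \<inter> dist_class n j"
      using assms by (auto simp: dist_class_def)
    then show "(\<Sum>z\<in>{z \<in> D \<times> D. dS n (fst z) (snd z) = j}. g (dS n (fst z) (snd z)))
        = real (card ((D \<times> D) \<inter> dist_class n j)) * g j"
      by (simp flip: \<open>_ = (D \<times> D) \<inter> dist_class n j\<close>)
  qed
  finally show ?thesis by (simp add: frequency_def sum_divide_distrib)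
qed

text \<open>The design condition is linear in the powers of the distance, so it passes to
  polynomials.\<close>

lemma design_poly:
  assumes D: "D \<subseteq> Sym n" "D \<noteq> {}" and design: "is_design n t D" and q: "degree q \<le> t"
  shows "(\<Sum>x\<in>D. \<Sum>y\<in>D. poly q (real (dS n x y))) / (real (card D))\<^sup>2
    = (\<Sum>p\<in>Sym n. poly q (real (n - num_fix n p))) / fact n"
proof -
  have pos: "card D > 0" using D finite_Sym finite_subset by (metis card_gt_0_iff)
  have mom: "(\<Sum>j=0..n. frequency n D j * real j ^ i)
      = (\<Sum>j=0..n. real (v n j) / fact n * real j ^ i)" if "i \<le> t" for i
  proof (cases "i = 0")
    \<comment> \<open>\<open>is_design\<close> starts at exponent 1; for exponent 0 both sides are
      total masses equal to 1.\<close>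
    case True
    with sum_frequency[OF D(1), of "\<lambda>_. 1"] sum_v[of n "\<lambda>_. 1"] pos show ?thesis
      by (simp add: card_Sym power2_eq_square)
  next
    case False
    with design that show ?thesis unfolding is_design_def by simp
  qed
  have expand: "(\<Sum>j=0..n. h j * poly q (real j))
      = (\<Sum>i\<le>degree q. coeff q i * (\<Sum>j=0..n. h j * real j ^ i))" for h :: "nat \<Rightarrow> real"
    unfolding poly_altdef sum_distrib_left by (subst sum.swap) (simp add: mult_ac)
  have "(\<Sum>j=0..n. frequency n D j * poly q (real j))
      = (\<Sum>j=0..n. real (v n j) / fact n * poly q (real j))"
    unfolding expand using q by (intro sum.cong refl arg_cong2[where f = "(*)"] mom) simp
  then show ?thesis by (simp only: sum_frequency[OF D(1)] sum_v)
qed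

text \<open>Averaged over \<open>x\<close> in \<open>D\<close> this is the design condition.
  \<open>kernel_mean_eq\<close> upgrades it to each single \<open>x\<close>, including those outside
  \<open>D\<close>.\<close>

lemma design_falling_mean:
  assumes D: "D \<subseteq> Sym n" "D \<noteq> {}" and design: "is_design n t D"
    and k: "k \<le> t" "k \<le> n" and x: "x \<in> Sym n"
  shows "(\<Sum>y\<in>D. falling k (real (num_fix n (x \<circ> inv y)))) = real (card D)"
proof -
  let ?T = "injective_lists k {1..n}"
  have pos: "card D > 0" using D finite_Sym finite_subset by (metis card_gt_0_iff)
  \<comment> \<open>Substituting \<open>n - X\<close> turns a polynomial in the number of agreements
    into one in the distance.\<close>
  define q where "q = falling_poly k \<circ>\<^sub>p [:real n, -1:]"
  have "degree q \<le> t"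
    unfolding q_def
    using degree_pcompose_le[of "falling_poly k" "[:real n, -1:]"] degree_falling_poly[of k] k
    by simp
  moreover have "poly q (real (n - num_fix n p)) = falling k (real (num_fix n p))" for p
    using num_fix_le[of n p] by (simp add: q_def poly_pcompose of_nat_diff)
  ultimately have "(\<Sum>x\<in>D. \<Sum>y\<in>D. falling k (real (num_fix n (x \<circ> inv y)))) / (real (card D))\<^sup>2 = 1"
    using design_poly[OF D design, of q]
    by (simp only: dS_def sum_falling_num_fix[OF k(2)]) simp
  then have DD: "(\<Sum>x\<in>D. \<Sum>y\<in>D. falling k (real (num_fix n (x \<circ> inv y)))) = (real (card D))\<^sup>2 * 1"
    using pos by (simp only: divide_eq_1_iff mult_1_right)
  have row: "(\<Sum>y\<in>Sym n. falling k (real (num_fix n (z \<circ> inv y)))) = real (card (Sym n)) * 1"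
    if "z \<in> Sym n" for z
    using sum_Sym_comp_inv[OF that, of "\<lambda>p. falling k (real (num_fix n p))"]
    by (simp add: sum_falling_num_fix[OF k(2)] card_Sym)
  define \<phi> :: "(nat \<Rightarrow> nat) \<Rightarrow> nat list \<times> nat list \<Rightarrow> real"
    where "\<phi> z i = of_bool (map z (fst i) = snd i)" for z i
  have kernel: "falling k (real (num_fix n (z \<circ> inv y))) = (\<Sum>i\<in>?T \<times> ?T. \<phi> z i * \<phi> y i)"
    if "z \<in> Sym n" "y \<in> Sym n" for z y
    unfolding falling_kernel[OF that] \<phi>_def case_prod_beta ..
  have "finite (?T \<times> ?T)" by (simp add: finite_injective_lists)
  from kernel_mean_eq[OF finite_Sym D this kernel row DD x] show ?thesis by simp
qed

text \<open>The polynomial \<open>falling n\<close> vanishes at 0, ..., n - 1, so it detects only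
  \<open>y = x\<close>. A permutation missing from \<open>D\<close> would have mean 0 where
  \<open>design_falling_mean\<close> demands 1.\<close>

lemma design_full:
  assumes D: "D \<subseteq> Sym n" "D \<noteq> {}" and design: "is_design n t D" and "n \<le> t"
  shows "D = Sym n"
proof -
  have "x \<in> D" if x: "x \<in> Sym n" for x
  proof (rule ccontr)
    assume "x \<notin> D"
    have "falling n (real (num_fix n (x \<circ> inv y))) = 0" if "y \<in> D" for y
    proof -
      have y: "y \<in> Sym n" using D that by auto
      have "num_fix n (x \<circ> inv y) < n"
      proof (rule ccontr)
        assume "\<not> ?thesis"
        then have "card {b \<in> {1..n}. x b = y b} = card {1..n}"
          using num_fix_le[of n "x \<circ> inv y"] by (simp add: num_fix_comp_inv[OF x y])
        then have "{b \<in> {1..n}. x b = y b} = {1..n}"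
          by (intro card_subset_eq) auto
        \<comment> \<open>Outside \<open>{1..n}\<close> both permutations are the identity.\<close>
        moreover have "x b = y b" if "b \<notin> {1..n}" for b
          using permutes_not_in[of x _ b] permutes_not_in[of y _ b] x y that
          unfolding Sym_def mem_Collect_eq by metis
        ultimately have "x b = y b" for b by blast
        with that \<open>x \<notin> D\<close> show False by (metis ext)
      qed
      then show ?thesis by (auto simp: falling_def)
    qed
    then have "real (card D) = 0"
      using design_falling_mean[OF D design \<open>n \<le> t\<close> order_refl x] by simp
    with D finite_Sym show False by (metis card_0_eq finite_subset of_nat_eq_0_iff)
  qed
  with D show ?thesis by auto
qed

theorem theorem2:
  fixes n t :: nat and D :: "(nat \<Rightarrow> nat) set"
  assumes "n \<ge> 1" and "t \<ge> 1"
    and "D \<subseteq> Sym n" and "D \<noteq> {}"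
    and "is_design n t D"
    and "D = Sym n \<longrightarrow> t \<le> n"
    and "half_strength t > 1"
  shows "real (covering_radius n D) < real n - largest_zero (half_strength t)"
proof -
  have finD: "finite D" using assms(3) finite_Sym finite_subset by blast
  \<comment> \<open>If \<open>t > n\<close>, then \<open>design_full\<close> gives
    \<open>D = Sym n\<close>, and the hypothesis on that case yields \<open>t \<le> n\<close>. Hence
    all moments up to \<open>t\<close> are available.\<close>
  have "t \<le> n" using design_full[OF assms(3-5)] assms(6) by linarith
  \<comment> \<open>The bound is proved at an \<open>x\<close> that attains the covering radius: one
    \<open>y\<close> in \<open>D\<close> with many agreements bounds its distance to
    \<open>D\<close>.\<close>
  have "covering_radius n D \<in> (\<lambda>x. Min ((\<lambda>y. dS n x y) ` D)) ` Sym n"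
    unfolding covering_radius_def using assms(3,4) by (intro Max_in) (auto simp: finite_Sym)
  then obtain x where x: "x \<in> Sym n" "covering_radius n D = Min ((\<lambda>y. dS n x y) ` D)"
    by blast
  have "\<exists>y\<in>D. largest_zero (half_strength t) < real (num_fix n (x \<circ> inv y))"
  proof (rule exceeds_largest_charlier_zero[where n = t and M = "real (card D)"])
    show "real (card D) \<noteq> 0" using finD assms(4) by simp
    show "(\<Sum>y\<in>D. falling k (real (num_fix n (x \<circ> inv y)))) = real (card D)" if "k \<le> t" for k
      using design_falling_mean[OF assms(3-5) that _ x(1)] that \<open>t \<le> n\<close> by simp
    show "2 * half_strength t - 1 \<le> t" by (simp add: half_strength_def)
  qed (use finD assms(7) in auto)
  then obtain y where y: "y \<in> D" "largest_zero (half_strength t) < real (num_fix n (x \<circ> inv y))"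
    by blast
  have "covering_radius n D \<le> dS n x y"
    using x(2) y(1) finD by simp
  then show ?thesis
    using y(2) num_fix_le[of n "x \<circ> inv y"] by (simp add: dS_def)
qed

end
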